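(* Let $n\ge2$ and let $K\subset\mathbb{R}^n$ be a convex body. Let $B$ be a rectangular box of smallest volume containing the projection body $\Pi K$, and let $\pm u_1,\ldots,\pm u_n$ be its outward unit normals. Then $F=\{u_1,\ldots,u_n\}$ is a best frame for $K$. Conversely, if $F=\{u_1,\ldots,u_n\}$ is a best frame for $K$, then the smallest rectangular box containing $\Pi K$ with outward unit normals $\pm u_1,\ldots,\pm u_n$ is a rectangular box of smallest volume (among all rectangular boxes) containing $\Pi K$.
   Context: A convex body is a compact convex set with nonempty interior. A rectangular box in $\mathbb{R}^n$ is a full-dimensional box whose edges are parallel to the vectors of some orthonormal basis (arbitrary orientation allowed). A frame is an orthonormal basis $F=\{u_1,\ldots,u_n\}$ of $\mathbb{R}^n$. $K|u^\perp$ denotes the orthogonal projection of $K$ onto the hyperplane $u^\perp$ through the origin perpendicular to $u$. Put $\Psi(K;F)=\prod_{i=1}^n \mathrm{vol}_{n-1}(K|u_i^\perp)$; a best frame for $K$ is a frame minimizing $\Psi(K;F)$ among all frames. The projection body $\Pi K$ is the convex body whose support function $h_{\Pi K}(u)=\max\{u^Tx: x\in \Pi K\}$ satisfies $h_{\Pi K}(u)=\mathrm{vol}_{n-1}(K|u^\perp)$ for all unit vectors $u$. *)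

theory Defs
  imports "HOL-Analysis.Analysis"
begin

definition convex_body :: "'a::euclidean_space set \<Rightarrow> bool" where
  "convex_body K \<longleftrightarrow> compact K \<and> convex K \<and> interior K \<noteq> {}"

definition orthonormal_basis_of :: "'a::euclidean_space set \<Rightarrow> 'a set \<Rightarrow> bool" where
  "orthonormal_basis_of V B \<longleftrightarrow>
     pairwise orthogonal B \<and> (\<forall>b\<in>B. norm b = 1) \<and> span B = V"

abbreviation frame :: "'a::euclidean_space set \<Rightarrow> bool" where
  "frame F \<equiv> orthonormal_basis_of UNIV F"

(* Lebesgue measure of S \<subseteq> V in its own dimension (dim V, not that of the ambient space):
   V is identified with R^B by orthonormal coordinates. By invariance of Lebesgue measure
   under linear isometries, the value does not depend on the choice of B. *)
definition subspace_volume :: "'a::euclidean_space set \<Rightarrow> 'a set \<Rightarrow> real" where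
  "subspace_volume V S =
     (let B = (SOME B. orthonormal_basis_of V B)
      in measure (\<Pi>\<^sub>M b\<in>B. lborel) ((\<lambda>x. \<lambda>b\<in>B. x \<bullet> b) ` S))"

definition perp :: "'a::euclidean_space \<Rightarrow> 'a set" where
  "perp u = {x. x \<bullet> u = 0}"

definition proj_perp :: "'a::euclidean_space \<Rightarrow> 'a \<Rightarrow> 'a" where
  "proj_perp u x = x - ((x \<bullet> u) / (u \<bullet> u)) *\<^sub>R u"

definition proj_volume :: "'a::euclidean_space set \<Rightarrow> 'a \<Rightarrow> real" where
  "proj_volume K u = subspace_volume (perp u) (proj_perp u ` K)"

definition Psi :: "'a::euclidean_space set \<Rightarrow> 'a set \<Rightarrow> real" where
  "Psi K F = (\<Prod>u\<in>F. proj_volume K u)"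

definition best_frame :: "'a::euclidean_space set \<Rightarrow> 'a set \<Rightarrow> bool" where
  "best_frame K F \<longleftrightarrow> frame F \<and> (\<forall>G. frame G \<longrightarrow> Psi K F \<le> Psi K G)"

(* On a nonempty compact set the supremum is a maximum. *)
definition support_function :: "'a::euclidean_space set \<Rightarrow> 'a \<Rightarrow> real" where
  "support_function P u = (SUP x\<in>P. u \<bullet> x)"

(* A relation rather than a function: P is determined by K, since a convex body is
   determined by its support function. *)
definition is_projection_body :: "'a::euclidean_space set \<Rightarrow> 'a set \<Rightarrow> bool" where
  "is_projection_body K P \<longleftrightarrow>
     convex_body P \<and> (\<forall>u. norm u = 1 \<longrightarrow> support_function P u = proj_volume K u)"

(* Rectangular box whose outward unit normals are u and -u for u in F;
   equivalently, its edges are parallel to the vectors of F. *)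
definition box_with_normals :: "'a::euclidean_space set \<Rightarrow> 'a set \<Rightarrow> bool" where
  "box_with_normals F B \<longleftrightarrow>
     frame F \<and>
     (\<exists>l r. (\<forall>u\<in>F. l u < r u) \<and> B = {x. \<forall>u\<in>F. l u \<le> x \<bullet> u \<and> x \<bullet> u \<le> r u})"

definition rectangular_box :: "'a::euclidean_space set \<Rightarrow> bool" where
  "rectangular_box B \<longleftrightarrow> (\<exists>F. box_with_normals F B)"

definition smallest_box :: "'a::euclidean_space set \<Rightarrow> 'a set \<Rightarrow> bool" where
  "smallest_box P B \<longleftrightarrow>
     rectangular_box B \<and> P \<subseteq> B \<and>
     (\<forall>B'. rectangular_box B' \<and> P \<subseteq> B' \<longrightarrow> measure lebesgue B \<le> measure lebesgue B')"

definition smallest_box_with_normals ::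
    "'a::euclidean_space set \<Rightarrow> 'a set \<Rightarrow> 'a set \<Rightarrow> bool" where
  "smallest_box_with_normals F P B \<longleftrightarrow>
     box_with_normals F B \<and> P \<subseteq> B \<and>
     (\<forall>B'. box_with_normals F B' \<and> P \<subseteq> B' \<longrightarrow> measure lebesgue B \<le> measure lebesgue B')"

end

theory Submission
  imports Defs
begin

text \<open>
  Since \<open>h_P\<close> is even, a rectangular box with normals \<open>F\<close> containing \<open>P\<close> has width at least
  \<open>2 h_P(u)\<close> in every direction \<open>u \<in> F\<close>, and the box with bounds \<open>\<plusminus>h_P(u)\<close> attains equality
  in all directions at once. So the smallest box with normals \<open>F\<close> has volume \<open>2 ^ n * \<Psi>(K;F)\<close>,
  and minimising the volume is minimising \<open>\<Psi>\<close>.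
\<close>

section \<open>Frames, the boxes they determine, and the volume of such a box\<close>

definition frame_box :: "'a::euclidean_space set \<Rightarrow> ('a \<Rightarrow> real) \<Rightarrow> ('a \<Rightarrow> real) \<Rightarrow> 'a set" where
  "frame_box F l r = {x. \<forall>u\<in>F. l u \<le> x \<bullet> u \<and> x \<bullet> u \<le> r u}"

lemma box_with_normals_iff:
  "box_with_normals F B \<longleftrightarrow> frame F \<and> (\<exists>l r. (\<forall>u\<in>F. l u < r u) \<and> B = frame_box F l r)"
  unfolding box_with_normals_def frame_box_def ..

lemma frame_finite_card:
  fixes F :: "'a::euclidean_space set"
  assumes "frame F"
  shows "finite F" "card F = DIM('a)"
proof -
  have "0 \<notin> F" using assms unfolding orthonormal_basis_of_def by force
  then have ind: "independent F"
    using assms pairwise_orthogonal_independent unfolding orthonormal_basis_of_def by blast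
  show "finite F" using ind by (rule independent_imp_finite)
  have "dim (span F) = card F" using ind by (simp add: dim_span dim_eq_card_independent)
  then show "card F = DIM('a)" using assms unfolding orthonormal_basis_of_def by simp
qed

text \<open>
  The library version needs a well-ordered index type. Vitali's covering theorem avoids this:
  up to a null set a box is a countable disjoint union of balls, which \<open>f\<close> maps to balls of the
  same radii.
\<close>

lemma measure_orthogonal_image_euclidean:
  fixes f :: "'a::euclidean_space \<Rightarrow> 'a"
  assumes f: "orthogonal_transformation f" and S: "S \<in> lmeasurable"
  shows "measure lebesgue (f ` S) = measure lebesgue S"
proof -
  have lin: "linear f" using f by (rule orthogonal_transformation_linear)
  have inj: "inj f" using f by (rule orthogonal_transformation_inj)
  \<comment> \<open>Boxes suffice: \<open>measure_linear_sufficient\<close> with factor 1 extends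
    the equality from boxes to all of \<open>lmeasurable\<close>.\<close>
  have "measure lebesgue (f ` cbox a b) = measure lebesgue (cbox a b)" for a b
  proof -
    define K where "K = {(x, r). ball x r \<subseteq> cbox a b}"
    have cov: "\<exists>i. i \<in> K \<and> x \<in> ball (fst i) (snd i) \<and> snd i < d" if "x \<in> box a b" "0 < d" for x d
    proof -
      obtain e where e: "e > 0" "ball x e \<subseteq> box a b"
        using \<open>x \<in> box a b\<close> open_box openE by blast
      \<comment> \<open>The bound \<open>e\<close> keeps the ball inside the box;
        \<open>d / 2\<close> makes its radius strictly smaller than \<open>d\<close>, as a Vitali
        cover requires.\<close>
      have "ball x (min e (d / 2)) \<subseteq> cbox a b"
        using e(2) box_subset_cbox[of a b] by auto
      then show ?thesis
        using e(1) \<open>0 < d\<close> by (intro exI[of _ "(x, min e (d / 2))"]) (auto simp: K_def)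
    qed
    obtain C where C: "countable C" "C \<subseteq> K"
      and disj: "pairwise (\<lambda>i j. disjnt (ball (fst i) (snd i)) (ball (fst j) (snd j))) C"
      and neg: "negligible (box a b - (\<Union>i\<in>C. ball (fst i) (snd i)))"
      using Vitali_covering_theorem_balls[of "box a b" K fst snd, OF cov] by blast
    define T where "T = (\<Union>i\<in>C. ball (fst i) (snd i))"
    have T: "T \<subseteq> cbox a b" using C(2) by (force simp: T_def K_def)
    \<comment> \<open>The exceptional set splits into the part of the open box missed by the balls
      and the boundary of the box, both null.\<close>
    have negT: "negligible (cbox a b - T)"
      by (rule negligible_subset[OF negligible_Un[OF neg negligible_frontier_interval]])
        (auto simp: T_def)
    \<comment> \<open>By injectivity the part missed by the image balls is the image of a null set,
      and a linear map, being differentiable, sends null sets to null sets.\<close>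
    have "f ` cbox a b - f ` T = f ` (cbox a b - T)" using inj by (simp add: image_set_diff)
    then have negfT: "negligible (f ` cbox a b - f ` T)"
      using negligible_differentiable_image_negligible[OF _ negT linear_imp_differentiable_on[OF lin]]
      by simp
    have ball: "f ` ball x r = ball (f x) r" for x r
      using f by (rule image_orthogonal_transformation_ball)
    have "emeasure lebesgue (f ` T) = emeasure lebesgue (\<Union>i\<in>C. ball (f (fst i)) (snd i))"
      by (simp add: T_def image_UN ball)
    also have "\<dots> = (\<integral>\<^sup>+i. emeasure lebesgue (ball (f (fst i)) (snd i)) \<partial>count_space C)"
    proof (rule emeasure_UN_countable)
      show "disjoint_family_on (\<lambda>i. ball (f (fst i)) (snd i)) C"
        using disj inj unfolding ball[symmetric] disjoint_family_on_def pairwise_def disjnt_def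
        by (metis image_Int image_empty)
    qed (use C in auto)
    also have "\<dots> = (\<integral>\<^sup>+i. emeasure lebesgue (ball (fst i) (snd i)) \<partial>count_space C)"
    proof (rule nn_integral_cong)
      fix i :: "'a \<times> real"
      show "emeasure lebesgue (ball (f (fst i)) (snd i)) = emeasure lebesgue (ball (fst i) (snd i))"
        \<comment> \<open>\<open>K\<close> also admits negative radii, for which both balls are
          empty; otherwise the volume of a ball depends on its radius alone.\<close>
        by (cases "0 \<le> snd i") (metis emeasure_lebesgue_ball_conv_unit_ball, simp add: ball_empty)
    qed
    also have "\<dots> = emeasure lebesgue T"
      unfolding T_def using C disj
      by (intro emeasure_UN_countable[symmetric])
        (auto simp: disjoint_family_on_def pairwise_def disjnt_def)
    finally have eq: "measure lebesgue (f ` T) = measure lebesgue T" by (simp add: measure_def)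
    have "measure lebesgue (cbox a b) = measure lebesgue T"
      using T negT by (intro measure_negligible_symdiff[symmetric]) (auto simp: Diff_eq_empty_iff[THEN iffD2])
    moreover have "measure lebesgue (f ` cbox a b) = measure lebesgue (f ` T)"
    proof (rule measure_negligible_symdiff[symmetric])
      show "f ` cbox a b \<in> lmeasurable"
        using lin by (intro lmeasurable_compact compact_continuous_image linear_continuous_on)
          (simp_all add: linear_linear)
      have "f ` T - f ` cbox a b = {}" using T by auto
      then show "negligible (f ` cbox a b - f ` T \<union> (f ` T - f ` cbox a b))" using negfT by simp
    qed
    ultimately show ?thesis using eq by simp
  qed
  then show ?thesis using measure_linear_sufficient[OF lin S, of 1] by simp
qed

text \<open>The orthogonal map sending the standard axes to \<open>F\<close> carries a coordinate
  box with the same side lengths onto the frame box. The order of the bounds matters: two reversed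
  pairs could make the product positive while the box is empty.\<close>

lemma measure_frame_box:
  fixes F :: "(real ^ 'n) set"
  assumes F: "frame F" and lr: "\<And>u. u \<in> F \<Longrightarrow> l u \<le> r u"
  shows "measure lebesgue (frame_box F l r) = (\<Prod>u\<in>F. r u - l u)"
proof -
  obtain e :: "'n \<Rightarrow> real ^ 'n" where e: "bij_betw e UNIV F"
    using frame_finite_card[OF F] finite_same_card_bij[of "UNIV :: 'n set" F] by auto
  have ee: "e i \<bullet> e j = (if i = j then 1 else 0)" for i j
  proof (cases "i = j")
    case True
    have "e j \<in> F" using e by (auto simp: bij_betw_def)
    then show ?thesis using F True by (simp add: orthonormal_basis_of_def dot_square_norm)
  next
    case False
    then have "e i \<noteq> e j" "e i \<in> F" "e j \<in> F" using e by (auto simp: bij_betw_def inj_def)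
    then show ?thesis using F False
      by (auto simp: orthonormal_basis_of_def pairwise_def orthogonal_def)
  qed
  define f where "f y = (\<Sum>i\<in>UNIV. (y $ i) *\<^sub>R e i)" for y :: "real ^ 'n"
  have fe: "f y \<bullet> e j = y $ j" for y j
    unfolding f_def by (simp add: inner_sum_left ee if_distrib cong: if_cong)
  have "linear f"
    unfolding f_def by (rule linearI) (simp_all add: algebra_simps sum.distrib scaleR_sum_right)
  moreover have "f v \<bullet> f w = v \<bullet> w" for v w
  proof -
    have "f v \<bullet> f w = (\<Sum>j\<in>UNIV. w $ j * (f v \<bullet> e j))"
      by (subst f_def[of w]) (simp add: inner_sum_right)
    also have "\<dots> = v \<bullet> w" by (simp only: fe) (simp add: inner_vec_def mult.commute)
    finally show ?thesis .
  qed
  ultimately have orth: "orthogonal_transformation f"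
    by (simp add: orthogonal_transformation_def)
  let ?C = "cbox (\<chi> i. l (e i)) (\<chi> i. r (e i))"
  have Fe: "F = range e" using e by (simp add: bij_betw_def)
  have "f y \<in> frame_box F l r \<longleftrightarrow> y \<in> ?C" for y
    by (simp add: frame_box_def Fe fe mem_box_cart)
  \<comment> \<open>Membership is only compared at points \<open>f y\<close>; surjectivity says that
    these are all points.\<close>
  moreover have "surj f" using orth by (rule orthogonal_transformation_surj)
  ultimately have "frame_box F l r = f ` ?C" by (auto simp: image_iff) (metis surj_def)
  then have "measure lebesgue (frame_box F l r) = measure lebesgue ?C"
    using measure_orthogonal_image_euclidean[OF orth] by simp
  also have "\<dots> = (\<Prod>i\<in>UNIV. r (e i) - l (e i))"
  proof -
    have "?C \<noteq> {}" using lr by (simp add: interval_ne_empty_cart Fe)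
    then show ?thesis by (simp add: content_cbox_cart)
  qed
  also have "\<dots> = (\<Prod>u\<in>F. r u - l u)" by (rule prod.reindex_bij_betw[OF e])
  finally show ?thesis .
qed

section \<open>Support function of the projection body\<close>

text \<open>Both the hyperplane and the projection onto it depend only on the line through
  \<open>u\<close>. Hence \<open>h_P\<close> is even on unit vectors, and its values bound
  \<open>P\<close> from both sides.\<close>

lemma proj_volume_uminus: "proj_volume K (- u) = proj_volume K u"
  by (simp add: proj_volume_def perp_def proj_perp_def[abs_def])

lemma inner_le_support_function:
  assumes "compact P" "x \<in> P"
  shows "x \<bullet> u \<le> support_function P u"
proof -
  have "compact ((\<lambda>x. u \<bullet> x) ` P)"
    using assms(1) by (intro compact_continuous_image continuous_intros)
  then show ?thesis unfolding support_function_def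
    by (subst inner_commute) (auto intro!: cSUP_upper assms(2) bounded_imp_bdd_above compact_imp_bounded)
qed

lemma width_pos:
  assumes "convex_body P" "u \<noteq> 0"
  shows "0 < support_function P u + support_function P (- u)"
proof -
  obtain x d where x: "x \<in> P" and d: "d > 0" "cball x d \<subseteq> P"
    using assms(1) unfolding convex_body_def mem_interior_cball
    by (metis all_not_in_conv centre_in_cball less_imp_le mem_interior_cball subsetD)
  let ?y = "x + (d / norm u) *\<^sub>R u"
  \<comment> \<open>The point lies at distance exactly \<open>d\<close> from \<open>x\<close>, hence
    the closed ball.\<close>
  have "?y \<in> P" using d assms(2) by (intro subsetD[OF d(2)]) (simp add: dist_norm)
  then have "?y \<bullet> u \<le> support_function P u" "x \<bullet> (- u) \<le> support_function P (- u)"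
    using assms(1) x by (auto simp: convex_body_def simp del: inner_minus_right
      intro!: inner_le_support_function)
  moreover have "?y \<bullet> u - x \<bullet> u > 0" using d assms(2) by (simp add: inner_add_left)
  ultimately show ?thesis by simp
qed

lemma projection_body_inner_le:
  assumes P: "is_projection_body K P" and "norm u = 1" "x \<in> P"
  shows "- proj_volume K u \<le> x \<bullet> u" "x \<bullet> u \<le> proj_volume K u"
proof -
  have "compact P" using P by (simp add: is_projection_body_def convex_body_def)
  from inner_le_support_function[OF this \<open>x \<in> P\<close>, of u]
    inner_le_support_function[OF this \<open>x \<in> P\<close>, of "- u"]
  show "- proj_volume K u \<le> x \<bullet> u" "x \<bullet> u \<le> proj_volume K u"
    using P \<open>norm u = 1\<close> by (auto simp: is_projection_body_def proj_volume_uminus)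
qed

lemma projection_body_bound:
  assumes P: "is_projection_body K P" and u: "norm u = 1"
    and le: "\<And>x. x \<in> P \<Longrightarrow> x \<bullet> u \<le> c"
  shows "proj_volume K u \<le> c"
proof -
  have "P \<noteq> {}" using P by (auto simp: is_projection_body_def convex_body_def)
  then have "support_function P u \<le> c"
    unfolding support_function_def by (rule cSUP_least) (metis le inner_commute)
  then show ?thesis using P u by (simp add: is_projection_body_def)
qed

text \<open>By evenness the width of \<open>P\<close> along \<open>u\<close> is twice the projection
  volume, so positivity comes from the interior of \<open>P\<close>, with no measure
  computed.\<close>

lemma proj_volume_pos:
  assumes P: "is_projection_body K P" and u: "norm u = 1"
  shows "0 < proj_volume K u"
proof -
  have "u \<noteq> 0" using u by auto
  with width_pos[of P u] show ?thesis
    using P u by (simp add: is_projection_body_def proj_volume_uminus)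
qed

lemma frame_norm: "frame F \<Longrightarrow> u \<in> F \<Longrightarrow> norm u = 1"
  by (simp add: orthonormal_basis_of_def)

section \<open>The tight box of a frame and its minimality\<close>

text \<open>The bounds are the values of \<open>h_P\<close> at \<open>u\<close> and
  \<open>- u\<close>, written through \<open>K\<close> so that the volume is directly a multiple of
  \<open>Psi K F\<close>.\<close>

definition tight_box :: "'a::euclidean_space set \<Rightarrow> 'a set \<Rightarrow> 'a set" where
  "tight_box K F = frame_box F (\<lambda>u. - proj_volume K u) (proj_volume K)"

context
  fixes K P F :: "(real ^ 'n) set"
  assumes P: "is_projection_body K P" and F: "frame F"
begin

lemma subset_tight_box: "P \<subseteq> tight_box K F"
  using projection_body_inner_le[OF P frame_norm[OF F]]
  by (auto simp: tight_box_def frame_box_def)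

lemma box_with_normals_tight_box: "box_with_normals F (tight_box K F)"
  unfolding box_with_normals_iff tight_box_def
proof (intro conjI exI)
  show "\<forall>u\<in>F. - proj_volume K u < proj_volume K u"
    using proj_volume_pos[OF P frame_norm[OF F]] by force
qed (rule F refl)+

lemma measure_tight_box: "measure lebesgue (tight_box K F) = 2 ^ CARD('n) * Psi K F"
proof -
  have "measure lebesgue (tight_box K F) = (\<Prod>u\<in>F. proj_volume K u - - proj_volume K u)"
    unfolding tight_box_def
    using proj_volume_pos[OF P frame_norm[OF F]]
    by (intro measure_frame_box[OF F]) force
  also have "\<dots> = (\<Prod>u\<in>F. 2 * proj_volume K u)" by simp
  also have "\<dots> = 2 ^ CARD('n) * Psi K F"
    using frame_finite_card[OF F] by (simp add: prod.distrib Psi_def)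
  finally show ?thesis .
qed

text \<open>The support value is the least upper bound of \<open>P\<close> along \<open>u\<close>;
  the lower face is the same argument for \<open>- u\<close>.\<close>

lemma frame_box_bounds:
  assumes sub: "P \<subseteq> frame_box F l r" and u: "u \<in> F"
  shows "l u \<le> - proj_volume K u" "proj_volume K u \<le> r u"
proof -
  note n = frame_norm[OF F u]
  show "proj_volume K u \<le> r u"
    using sub u by (intro projection_body_bound[OF P n]) (auto simp: frame_box_def)
  have "proj_volume K (- u) \<le> - l u"
    using sub u n by (intro projection_body_bound[OF P]) (auto simp: frame_box_def)
  then show "l u \<le> - proj_volume K u" by (simp add: proj_volume_uminus)
qed

text \<open>Volumes are compared factor by factor. If any face of \<open>B\<close> is not tight, one
  factor is strictly larger, and positivity of all factors makes the product strictly larger; so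
  equal volume forces equal boxes.\<close>

lemma tight_box_minimal:
  assumes B: "box_with_normals F B" "P \<subseteq> B"
  shows "measure lebesgue (tight_box K F) \<le> measure lebesgue B"
    and "measure lebesgue B = measure lebesgue (tight_box K F) \<Longrightarrow> B = tight_box K F"
proof -
  obtain l r where lr: "\<And>u. u \<in> F \<Longrightarrow> l u < r u" and Beq: "B = frame_box F l r"
    using B(1) by (auto simp: box_with_normals_iff)
  let ?h = "proj_volume K"
  note bounds = frame_box_bounds[OF B(2)[unfolded Beq]]
  note pos = proj_volume_pos[OF P frame_norm[OF F]]
  have mB: "measure lebesgue B = (\<Prod>u\<in>F. r u - l u)"
    unfolding Beq using lr by (intro measure_frame_box[OF F]) (simp add: less_imp_le)
  have mT: "measure lebesgue (tight_box K F) = (\<Prod>u\<in>F. ?h u - - ?h u)"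
    unfolding tight_box_def using pos by (intro measure_frame_box[OF F]) force
  have le: "0 < ?h u - - ?h u" "?h u - - ?h u \<le> r u - l u" if "u \<in> F" for u
    using bounds[OF that] pos[OF that] by linarith+
  show "measure lebesgue (tight_box K F) \<le> measure lebesgue B"
    unfolding mB mT using le by (intro prod_mono) (simp add: less_imp_le)
  assume eq: "measure lebesgue B = measure lebesgue (tight_box K F)"
  have "l u = - ?h u \<and> r u = ?h u" if u: "u \<in> F" for u
  proof (rule ccontr)
    assume "\<not> (l u = - ?h u \<and> r u = ?h u)"
    then have "?h u - - ?h u < r u - l u" using bounds[OF u] by linarith
    then have "(\<Prod>u\<in>F. ?h u - - ?h u) < (\<Prod>u\<in>F. r u - l u)"
      using frame_finite_card(1)[OF F] u
      by (intro prod_mono_strict[of u]) (use le lr in \<open>auto simp: less_imp_le\<close>)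
    with eq show False unfolding mB mT by simp
  qed
  then show "B = tight_box K F" by (auto simp: Beq tight_box_def frame_box_def)
qed

lemma smallest_box_with_normals_iff:
  "smallest_box_with_normals F P B \<longleftrightarrow> B = tight_box K F"
  using tight_box_minimal subset_tight_box box_with_normals_tight_box
  unfolding smallest_box_with_normals_def by (metis order_antisym)

end

section \<open>Comparison of boxes over all frames\<close>

theorem lemma7:
  fixes K P :: "(real ^ 'n) set"
  assumes "CARD('n) \<ge> 2"
    and "convex_body K"
    and "is_projection_body K P"
  shows "(\<forall>B F. smallest_box P B \<and> box_with_normals F B \<longrightarrow> best_frame K F) \<and>
         (\<forall>F. best_frame K F \<longrightarrow>
            (\<exists>!B. smallest_box_with_normals F P B) \<and>
            (\<forall>B. smallest_box_with_normals F P B \<longrightarrow> smallest_box P B))"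
proof (intro conjI allI impI)
  note P = assms(3)
  have lower: "2 ^ CARD('n) * Psi K G \<le> measure lebesgue B"
    if "box_with_normals G B" "P \<subseteq> B" for G B
  proof -
    have G: "frame G" using that(1) by (simp add: box_with_normals_def)
    show ?thesis
      using tight_box_minimal(1)[OF P G that] by (simp add: measure_tight_box[OF P G])
  qed
  {
    fix B F assume B: "smallest_box P B \<and> box_with_normals F B"
    \<comment> \<open>The tight box of \<open>G\<close> competes with \<open>B\<close>, while
      \<open>lower\<close> bounds the volume of \<open>B\<close> from below by its own frame. That
      \<open>B\<close> is itself tight need not be shown.\<close>
    have "Psi K F \<le> Psi K G" if G: "frame G" for G
    proof -
      have "2 ^ CARD('n) * Psi K F \<le> measure lebesgue B"
        using B by (intro lower) (auto simp: smallest_box_def)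
      also have "\<dots> \<le> measure lebesgue (tight_box K G)"
        using B box_with_normals_tight_box[OF P G] subset_tight_box[OF P G]
        by (auto simp: smallest_box_def rectangular_box_def)
      also have "\<dots> = 2 ^ CARD('n) * Psi K G" by (rule measure_tight_box[OF P G])
      finally show ?thesis by simp
    qed
    then show "best_frame K F" using B by (simp add: best_frame_def box_with_normals_def)
  next
    fix F assume "best_frame K F"
    then have "frame F" by (simp add: best_frame_def)
    then show "\<exists>!B. smallest_box_with_normals F P B"
      by (simp add: smallest_box_with_normals_iff[OF P])
  next
    fix F B assume best: "best_frame K F" and "smallest_box_with_normals F P B"
    have F: "frame F" using best by (simp add: best_frame_def)
    have B: "B = tight_box K F"
      using \<open>smallest_box_with_normals F P B\<close> by (simp add: smallest_box_with_normals_iff[OF P F])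
    \<comment> \<open>A competitor may have any frame \<open>G\<close>: pass from
      \<open>Psi K F\<close> to \<open>Psi K G\<close> because \<open>F\<close> is best, then to
      \<open>B'\<close> by \<open>lower\<close>.\<close>
    have "measure lebesgue B \<le> measure lebesgue B'"
      if "box_with_normals G B'" "P \<subseteq> B'" for G B'
    proof -
      have "Psi K F \<le> Psi K G"
        using best that(1) by (simp add: best_frame_def box_with_normals_def)
      then have "measure lebesgue B \<le> 2 ^ CARD('n) * Psi K G"
        by (simp add: B measure_tight_box[OF P F])
      also have "\<dots> \<le> measure lebesgue B'" by (rule lower[OF that])
      finally show ?thesis .
    qed
    then show "smallest_box P B"
      using box_with_normals_tight_box[OF P F] subset_tight_box[OF P F]
      by (auto simp: smallest_box_def rectangular_box_def B)
  }
qed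

end
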